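(* Let $T$ be a theory (a set of sentences of the language of arithmetic). If $T$ is a consistent extension of Robinson arithmetic $Q$ and the set $\mathcal{Pr}_T$ of Gödel numbers of sentences provable in $T$ is definable in the standard model $\omega$, then the sentence $\psi(n,t)$ is true in $\omega$, but $T\not\vdash\psi(n,t)$. Here the formula $\psi(v_0,v_1)$, the closed term $t$ and the number $n$ are those constructed from $T$ in the context.
   Context: **Language and basic notions.** Fix a standard first-order language of arithmetic (with equality, constant $0$, unary function symbol $s$, binary function symbols $+,\cdot$, order $\le$ primitive or defined; $x<y$ means $x\le y\wedge x\ne y$). Formulas, sentences and terms are those of this language; the variables $v_0,v_1,v_2,\dots$ each count as one primitive symbol, and apart from the variables there are only finitely many primitive symbols. Terms are written with infix $\cdot$ and parentheses. A theory is an arbitrary set of sentences. $Q$ is Robinson arithmetic, with axioms $s(x)\neq 0$; $s(x)=s(y)\to x=y$; $x\ne0\to\exists y\,(x=s(y))$; $x+0=x$; $x+s(y)=s(x+y)$; $x\cdot 0=0$; $x\cdot s(y)=x\cdot y+x$; $x\le y\leftrightarrow\exists z\,(z+x=y)$. An extension of $Q$ is a theory proving all axioms of $Q$. $\omega$ denotes the standard model (and the set of natural numbers); "true" and "definable" mean true and definable in $\omega$. For $i\in\omega$, $\underline{i}$ is the numeral $s\cdots s0$ ($i$ occurrences of $s$); $i$ is written for $\underline i$ inside formulas. Fix a standard Gödel numbering; $\ulcorner\mu\urcorner$ is the Gödel number of $\mu$. A theory is recursively axiomatizable if it has the same theorems as some theory whose set of Gödel numbers is recursive. A formula is $\Sigma_1$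 if it is of the form $(\exists v_i)\mu$ with $\mu$ a $\Delta_0$ (bounded) formula. **Length and naming.** $|e|$ is the number of symbol occurrences in a term or formula $e$ (its length). A formula $\mu$ names the number $i$ if $\mu=\mu(v_0)$ has at most the free variable $v_0$ and $T\vdash(\forall v_0)(\mu(v_0)\leftrightarrow v_0=i)$. **The relation $\mathcal B$ and the formulas $\varphi,\psi$.** Fix a recursive function $g$ such that for every formula $\mu$ and number $j$: if all variables of $\mu$ are among the first $j$ variables $v_0,\dots,v_{j-1}$ and $|\mu|<j$, then $\ulcorner\mu\urcorner<g(j)$ (such a $g$ exists). Let $$\mathcal B=\{(i,j)\in\omega^2:\ \text{there is a formula }\mu\text{ with }\ulcorner\mu\urcorner<g(j),\ |\mu|<j,\text{ and }\mu\text{ names }i\}.$$ If $\mathcal{Pr}_T$ is definable, then so is $\mathcal B$. Let $\varphi(v_0,v_1)$ be a formula with at most the free variables $v_0,v_1$ defining $\mathcal B$, chosen to be $\Sigma_1$ whenever $T$ is recursively axiomatizable (with bound variables such that the substitution below is free). Let $$\psi(v_0,v_1):=\neg\varphi(v_0,v_1)\wedge(\forall v_2<v_0)\,\varphi(v_2,v_1).$$ **The term $t$ and the number $n$.** Let $k_1=|\psi(v_0,v_1)|$, let $k_2$ be any natural number greater than the number of free occurrences of $v_1$ in $\psi(v_0,v_1)$, let $k=k_1k_2$, and let $t$ be the closed term $\underline{10}\cdot(\underline{k}\cdot\underline{k})$, with value $\mathbf t=10k^2$. If $T$ is a consistent extension of $Q$, only finitely many numbers can be named by formulas of length less than $\mathbf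 t$; $n$ is the least number that cannot be named by a formula of length less than $\mathbf t$. *)

theory Defs
  imports Main "HOL-Library.Nat_Bijection"
begin

section \<open>Syntax of the language of arithmetic\<close>

text \<open>Variables are named: \<open>Var i\<close> is $v_i$. The order \<open>\<le>\<close> is a primitive relation symbol.\<close>

datatype tm = Var nat | Zero | Succ tm | Plus tm tm | Times tm tm

datatype fm =
    Eq tm tm | Leq tm tm
  | Neg fm | Conj fm fm | Disj fm fm | Imp fm fm | Iff fm fm
  | All nat fm | Ex nat fm

definition Less :: "tm \<Rightarrow> tm \<Rightarrow> fm" where
  "Less s u = Conj (Leq s u) (Neg (Eq s u))"

fun vars_tm :: "tm \<Rightarrow> nat set" where
  "vars_tm (Var i) = {i}"
| "vars_tm Zero = {}"
| "vars_tm (Succ s) = vars_tm s"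
| "vars_tm (Plus s u) = vars_tm s \<union> vars_tm u"
| "vars_tm (Times s u) = vars_tm s \<union> vars_tm u"

text \<open>All variables of a formula, including those that occur only bound or only next to a
  quantifier.\<close>

fun vars_fm :: "fm \<Rightarrow> nat set" where
  "vars_fm (Eq s u) = vars_tm s \<union> vars_tm u"
| "vars_fm (Leq s u) = vars_tm s \<union> vars_tm u"
| "vars_fm (Neg \<alpha>) = vars_fm \<alpha>"
| "vars_fm (Conj \<alpha> \<beta>) = vars_fm \<alpha> \<union> vars_fm \<beta>"
| "vars_fm (Disj \<alpha> \<beta>) = vars_fm \<alpha> \<union> vars_fm \<beta>"
| "vars_fm (Imp \<alpha> \<beta>) = vars_fm \<alpha> \<union> vars_fm \<beta>"
| "vars_fm (Iff \<alpha> \<beta>) = vars_fm \<alpha> \<union> vars_fm \<beta>"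
| "vars_fm (All x \<alpha>) = insert x (vars_fm \<alpha>)"
| "vars_fm (Ex x \<alpha>) = insert x (vars_fm \<alpha>)"

fun fv :: "fm \<Rightarrow> nat set" where
  "fv (Eq s u) = vars_tm s \<union> vars_tm u"
| "fv (Leq s u) = vars_tm s \<union> vars_tm u"
| "fv (Neg \<alpha>) = fv \<alpha>"
| "fv (Conj \<alpha> \<beta>) = fv \<alpha> \<union> fv \<beta>"
| "fv (Disj \<alpha> \<beta>) = fv \<alpha> \<union> fv \<beta>"
| "fv (Imp \<alpha> \<beta>) = fv \<alpha> \<union> fv \<beta>"
| "fv (Iff \<alpha> \<beta>) = fv \<alpha> \<union> fv \<beta>"
| "fv (All x \<alpha>) = fv \<alpha> - {x}"
| "fv (Ex x \<alpha>) = fv \<alpha> - {x}"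

definition sentence :: "fm \<Rightarrow> bool" where
  "sentence \<alpha> \<longleftrightarrow> fv \<alpha> = {}"

fun occ_tm :: "nat \<Rightarrow> tm \<Rightarrow> nat" where
  "occ_tm x (Var i) = (if i = x then 1 else 0)"
| "occ_tm x Zero = 0"
| "occ_tm x (Succ s) = occ_tm x s"
| "occ_tm x (Plus s u) = occ_tm x s + occ_tm x u"
| "occ_tm x (Times s u) = occ_tm x s + occ_tm x u"

fun free_occ :: "nat \<Rightarrow> fm \<Rightarrow> nat" where
  "free_occ x (Eq s u) = occ_tm x s + occ_tm x u"
| "free_occ x (Leq s u) = occ_tm x s + occ_tm x u"
| "free_occ x (Neg \<alpha>) = free_occ x \<alpha>"
| "free_occ x (Conj \<alpha> \<beta>) = free_occ x \<alpha> + free_occ x \<beta>"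
| "free_occ x (Disj \<alpha> \<beta>) = free_occ x \<alpha> + free_occ x \<beta>"
| "free_occ x (Imp \<alpha> \<beta>) = free_occ x \<alpha> + free_occ x \<beta>"
| "free_occ x (Iff \<alpha> \<beta>) = free_occ x \<alpha> + free_occ x \<beta>"
| "free_occ x (All y \<alpha>) = (if y = x then 0 else free_occ x \<alpha>)"
| "free_occ x (Ex y \<alpha>) = (if y = x then 0 else free_occ x \<alpha>)"

primrec num :: "nat \<Rightarrow> tm" where
  "num 0 = Zero"
| "num (Suc i) = Succ (num i)"

text \<open>\<open>subst_fm x s \<alpha>\<close> replaces the free occurrences of $v_x$ in \<open>\<alpha>\<close> by \<open>s\<close> without renaming
  bound variables; \<open>free_for s x \<alpha>\<close> says that no variable of \<open>s\<close> is captured thereby.\<close>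

fun subst_tm :: "nat \<Rightarrow> tm \<Rightarrow> tm \<Rightarrow> tm" where
  "subst_tm x s (Var i) = (if i = x then s else Var i)"
| "subst_tm x s Zero = Zero"
| "subst_tm x s (Succ u) = Succ (subst_tm x s u)"
| "subst_tm x s (Plus u w) = Plus (subst_tm x s u) (subst_tm x s w)"
| "subst_tm x s (Times u w) = Times (subst_tm x s u) (subst_tm x s w)"

fun subst_fm :: "nat \<Rightarrow> tm \<Rightarrow> fm \<Rightarrow> fm" where
  "subst_fm x s (Eq u w) = Eq (subst_tm x s u) (subst_tm x s w)"
| "subst_fm x s (Leq u w) = Leq (subst_tm x s u) (subst_tm x s w)"
| "subst_fm x s (Neg \<alpha>) = Neg (subst_fm x s \<alpha>)"
| "subst_fm x s (Conj \<alpha> \<beta>) = Conj (subst_fm x s \<alpha>) (subst_fm x s \<beta>)"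
| "subst_fm x s (Disj \<alpha> \<beta>) = Disj (subst_fm x s \<alpha>) (subst_fm x s \<beta>)"
| "subst_fm x s (Imp \<alpha> \<beta>) = Imp (subst_fm x s \<alpha>) (subst_fm x s \<beta>)"
| "subst_fm x s (Iff \<alpha> \<beta>) = Iff (subst_fm x s \<alpha>) (subst_fm x s \<beta>)"
| "subst_fm x s (All y \<alpha>) = All y (if y = x then \<alpha> else subst_fm x s \<alpha>)"
| "subst_fm x s (Ex y \<alpha>) = Ex y (if y = x then \<alpha> else subst_fm x s \<alpha>)"

fun free_for :: "tm \<Rightarrow> nat \<Rightarrow> fm \<Rightarrow> bool" where
  "free_for s x (Eq u w) = True"
| "free_for s x (Leq u w) = True"
| "free_for s x (Neg \<alpha>) = free_for s x \<alpha>"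
| "free_for s x (Conj \<alpha> \<beta>) = (free_for s x \<alpha> \<and> free_for s x \<beta>)"
| "free_for s x (Disj \<alpha> \<beta>) = (free_for s x \<alpha> \<and> free_for s x \<beta>)"
| "free_for s x (Imp \<alpha> \<beta>) = (free_for s x \<alpha> \<and> free_for s x \<beta>)"
| "free_for s x (Iff \<alpha> \<beta>) = (free_for s x \<alpha> \<and> free_for s x \<beta>)"
| "free_for s x (All y \<alpha>) = (x \<notin> fv (All y \<alpha>) \<or> y \<notin> vars_tm s \<and> free_for s x \<alpha>)"
| "free_for s x (Ex y \<alpha>) = (x \<notin> fv (Ex y \<alpha>) \<or> y \<notin> vars_tm s \<and> free_for s x \<alpha>)"


section \<open>Length and Goedel numbers\<close>

text \<open>A formula is written out as a string of symbols, each variable being one symbol. Its length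
  is the length of that string, and its Goedel number is the code of that string.\<close>

datatype sym =
    LPar | RPar | ZeroS | SuccS | PlusS | TimesS | EqS | LeqS
  | NegS | ConjS | DisjS | ImpS | IffS | AllS | ExS | VarS nat

fun str_tm :: "tm \<Rightarrow> sym list" where
  "str_tm (Var i) = [VarS i]"
| "str_tm Zero = [ZeroS]"
| "str_tm (Succ s) = SuccS # str_tm s"
| "str_tm (Plus s u) = [LPar] @ str_tm s @ [PlusS] @ str_tm u @ [RPar]"
| "str_tm (Times s u) = [LPar] @ str_tm s @ [TimesS] @ str_tm u @ [RPar]"

fun str_fm :: "fm \<Rightarrow> sym list" where
  "str_fm (Eq s u) = str_tm s @ [EqS] @ str_tm u"
| "str_fm (Leq s u) = str_tm s @ [LeqS] @ str_tm u"
| "str_fm (Neg \<alpha>) = NegS # str_fm \<alpha>"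
| "str_fm (Conj \<alpha> \<beta>) = [LPar] @ str_fm \<alpha> @ [ConjS] @ str_fm \<beta> @ [RPar]"
| "str_fm (Disj \<alpha> \<beta>) = [LPar] @ str_fm \<alpha> @ [DisjS] @ str_fm \<beta> @ [RPar]"
| "str_fm (Imp \<alpha> \<beta>) = [LPar] @ str_fm \<alpha> @ [ImpS] @ str_fm \<beta> @ [RPar]"
| "str_fm (Iff \<alpha> \<beta>) = [LPar] @ str_fm \<alpha> @ [IffS] @ str_fm \<beta> @ [RPar]"
| "str_fm (All x \<alpha>) = [LPar, AllS, VarS x, RPar] @ str_fm \<alpha>"
| "str_fm (Ex x \<alpha>) = [LPar, ExS, VarS x, RPar] @ str_fm \<alpha>"

definition len_fm :: "fm \<Rightarrow> nat" where
  "len_fm \<alpha> = length (str_fm \<alpha>)"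

fun sym_code :: "sym \<Rightarrow> nat" where
  "sym_code LPar = 0"
| "sym_code RPar = 1"
| "sym_code ZeroS = 2"
| "sym_code SuccS = 3"
| "sym_code PlusS = 4"
| "sym_code TimesS = 5"
| "sym_code EqS = 6"
| "sym_code LeqS = 7"
| "sym_code NegS = 8"
| "sym_code ConjS = 9"
| "sym_code DisjS = 10"
| "sym_code ImpS = 11"
| "sym_code IffS = 12"
| "sym_code AllS = 13"
| "sym_code ExS = 14"
| "sym_code (VarS i) = 15 + i"

definition goedel :: "fm \<Rightarrow> nat" where
  "goedel \<alpha> = list_encode (map sym_code (str_fm \<alpha>))"


section \<open>First-order provability\<close>

text \<open>A Hilbert calculus for classical first-order logic with equality in the style of Enderton:
  modus ponens is the only rule, and the logical axioms are closed under generalization.\<close>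

text \<open>Propositional evaluation; atomic and quantified formulas are the prime formulas.\<close>

fun prop_eval :: "(fm \<Rightarrow> bool) \<Rightarrow> fm \<Rightarrow> bool" where
  "prop_eval V (Neg \<alpha>) = (\<not> prop_eval V \<alpha>)"
| "prop_eval V (Conj \<alpha> \<beta>) = (prop_eval V \<alpha> \<and> prop_eval V \<beta>)"
| "prop_eval V (Disj \<alpha> \<beta>) = (prop_eval V \<alpha> \<or> prop_eval V \<beta>)"
| "prop_eval V (Imp \<alpha> \<beta>) = (prop_eval V \<alpha> \<longrightarrow> prop_eval V \<beta>)"
| "prop_eval V (Iff \<alpha> \<beta>) = (prop_eval V \<alpha> \<longleftrightarrow> prop_eval V \<beta>)"
| "prop_eval V \<alpha> = V \<alpha>"

definition tautology :: "fm \<Rightarrow> bool" where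
  "tautology \<alpha> \<longleftrightarrow> (\<forall>V. prop_eval V \<alpha>)"

inductive logical_axiom :: "fm \<Rightarrow> bool" where
  taut: "tautology \<alpha> \<Longrightarrow> logical_axiom \<alpha>"
| inst: "free_for s x \<alpha> \<Longrightarrow> logical_axiom (Imp (All x \<alpha>) (subst_fm x s \<alpha>))"
| dist: "logical_axiom (Imp (All x (Imp \<alpha> \<beta>)) (Imp (All x \<alpha>) (All x \<beta>)))"
| vac: "x \<notin> fv \<alpha> \<Longrightarrow> logical_axiom (Imp \<alpha> (All x \<alpha>))"
| ex_all: "logical_axiom (Iff (Ex x \<alpha>) (Neg (All x (Neg \<alpha>))))"
| eq_refl: "logical_axiom (Eq s s)"
| eq_subst: "free_for s x \<alpha> \<Longrightarrow> free_for u x \<alpha> \<Longrightarrow>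
    logical_axiom (Imp (Eq s u) (Imp (subst_fm x s \<alpha>) (subst_fm x u \<alpha>)))"
| gen: "logical_axiom \<alpha> \<Longrightarrow> logical_axiom (All x \<alpha>)"

inductive proves :: "fm set \<Rightarrow> fm \<Rightarrow> bool"  (infix "\<turnstile>" 50) for T :: "fm set" where
  hyp: "\<alpha> \<in> T \<Longrightarrow> T \<turnstile> \<alpha>"
| logical: "logical_axiom \<alpha> \<Longrightarrow> T \<turnstile> \<alpha>"
| mp: "T \<turnstile> Imp \<alpha> \<beta> \<Longrightarrow> T \<turnstile> \<alpha> \<Longrightarrow> T \<turnstile> \<beta>"

definition consistent :: "fm set \<Rightarrow> bool" where
  "consistent T \<longleftrightarrow> \<not> (\<exists>\<alpha>. T \<turnstile> \<alpha> \<and> T \<turnstile> Neg \<alpha>)"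

definition Q_axioms :: "fm set" where
  "Q_axioms =
    {All 0 (Neg (Eq (Succ (Var 0)) Zero)),
     All 0 (All 1 (Imp (Eq (Succ (Var 0)) (Succ (Var 1))) (Eq (Var 0) (Var 1)))),
     All 0 (Imp (Neg (Eq (Var 0) Zero)) (Ex 1 (Eq (Var 0) (Succ (Var 1))))),
     All 0 (Eq (Plus (Var 0) Zero) (Var 0)),
     All 0 (All 1 (Eq (Plus (Var 0) (Succ (Var 1))) (Succ (Plus (Var 0) (Var 1))))),
     All 0 (Eq (Times (Var 0) Zero) Zero),
     All 0 (All 1 (Eq (Times (Var 0) (Succ (Var 1))) (Plus (Times (Var 0) (Var 1)) (Var 0)))),
     All 0 (All 1 (Iff (Leq (Var 0) (Var 1)) (Ex 2 (Eq (Plus (Var 2) (Var 0)) (Var 1)))))}"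

definition extends_Q :: "fm set \<Rightarrow> bool" where
  "extends_Q T \<longleftrightarrow> (\<forall>\<alpha>\<in>Q_axioms. T \<turnstile> \<alpha>)"

definition Pr :: "fm set \<Rightarrow> nat set" where
  "Pr T = {goedel \<alpha> |\<alpha>. sentence \<alpha> \<and> T \<turnstile> \<alpha>}"


section \<open>Truth and definability in the standard model\<close>

fun val :: "(nat \<Rightarrow> nat) \<Rightarrow> tm \<Rightarrow> nat" where
  "val e (Var i) = e i"
| "val e Zero = 0"
| "val e (Succ s) = Suc (val e s)"
| "val e (Plus s u) = val e s + val e u"
| "val e (Times s u) = val e s * val e u"

fun sat :: "(nat \<Rightarrow> nat) \<Rightarrow> fm \<Rightarrow> bool" where
  "sat e (Eq s u) = (val e s = val e u)"
| "sat e (Leq s u) = (val e s \<le> val e u)"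
| "sat e (Neg \<alpha>) = (\<not> sat e \<alpha>)"
| "sat e (Conj \<alpha> \<beta>) = (sat e \<alpha> \<and> sat e \<beta>)"
| "sat e (Disj \<alpha> \<beta>) = (sat e \<alpha> \<or> sat e \<beta>)"
| "sat e (Imp \<alpha> \<beta>) = (sat e \<alpha> \<longrightarrow> sat e \<beta>)"
| "sat e (Iff \<alpha> \<beta>) = (sat e \<alpha> \<longleftrightarrow> sat e \<beta>)"
| "sat e (All x \<alpha>) = (\<forall>a. sat (e(x := a)) \<alpha>)"
| "sat e (Ex x \<alpha>) = (\<exists>a. sat (e(x := a)) \<alpha>)"

definition true_in_omega :: "fm \<Rightarrow> bool" where
  "true_in_omega \<alpha> \<longleftrightarrow> (\<forall>e. sat e \<alpha>)"

definition definable :: "nat set \<Rightarrow> bool" where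
  "definable A \<longleftrightarrow> (\<exists>\<chi>. fv \<chi> \<subseteq> {0} \<and> (\<forall>e i. i \<in> A \<longleftrightarrow> sat (e(0 := i)) \<chi>))"

definition defines_rel :: "fm \<Rightarrow> (nat \<times> nat) set \<Rightarrow> bool" where
  "defines_rel \<chi> R \<longleftrightarrow>
     fv \<chi> \<subseteq> {0, 1} \<and> (\<forall>e i j. (i, j) \<in> R \<longleftrightarrow> sat (e(0 := i, 1 := j)) \<chi>)"


section \<open>Recursive functions and sets\<close>

text \<open>Codes for partial recursive functions: zero, successor, projections, composition, primitive
  recursion on the first argument, and minimization over the first argument.\<close>

datatype recf = ZeroF | SuccF | Proj nat | Comp recf "recf list" | PrimRec recf recf | Mu recf

inductive rec_eval :: "recf \<Rightarrow> nat list \<Rightarrow> nat \<Rightarrow> bool" where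
  "rec_eval ZeroF xs 0"
| "rec_eval SuccF [x] (Suc x)"
| "i < length xs \<Longrightarrow> rec_eval (Proj i) xs (xs ! i)"
| "length ys = length fs \<Longrightarrow> (\<forall>i<length fs. rec_eval (fs ! i) xs (ys ! i)) \<Longrightarrow>
    rec_eval f ys y \<Longrightarrow> rec_eval (Comp f fs) xs y"
| "rec_eval f xs y \<Longrightarrow> rec_eval (PrimRec f h) (0 # xs) y"
| "rec_eval (PrimRec f h) (m # xs) z \<Longrightarrow> rec_eval h (m # z # xs) y \<Longrightarrow>
    rec_eval (PrimRec f h) (Suc m # xs) y"
| "rec_eval f (y # xs) 0 \<Longrightarrow> (\<forall>m<y. \<exists>z>0. rec_eval f (m # xs) z) \<Longrightarrow> rec_eval (Mu f) xs y"

definition recursive_fun :: "(nat \<Rightarrow> nat) \<Rightarrow> bool" where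
  "recursive_fun g \<longleftrightarrow> (\<exists>f. \<forall>x y. rec_eval f [x] y \<longleftrightarrow> y = g x)"

definition recursive_set :: "nat set \<Rightarrow> bool" where
  "recursive_set A \<longleftrightarrow> recursive_fun (\<lambda>i. if i \<in> A then 1 else 0)"

definition recursively_axiomatizable :: "fm set \<Rightarrow> bool" where
  "recursively_axiomatizable T \<longleftrightarrow>
     (\<exists>T'. (\<forall>\<alpha>\<in>T'. sentence \<alpha>) \<and> recursive_set (goedel ` T') \<and>
        (\<forall>\<alpha>. sentence \<alpha> \<longrightarrow> (T \<turnstile> \<alpha> \<longleftrightarrow> T' \<turnstile> \<alpha>)))"

inductive Delta0 :: "fm \<Rightarrow> bool" where
  "Delta0 (Eq s u)"
| "Delta0 (Leq s u)"
| "Delta0 \<alpha> \<Longrightarrow> Delta0 (Neg \<alpha>)"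
| "Delta0 \<alpha> \<Longrightarrow> Delta0 \<beta> \<Longrightarrow> Delta0 (Conj \<alpha> \<beta>)"
| "Delta0 \<alpha> \<Longrightarrow> Delta0 \<beta> \<Longrightarrow> Delta0 (Disj \<alpha> \<beta>)"
| "Delta0 \<alpha> \<Longrightarrow> Delta0 \<beta> \<Longrightarrow> Delta0 (Imp \<alpha> \<beta>)"
| "Delta0 \<alpha> \<Longrightarrow> Delta0 \<beta> \<Longrightarrow> Delta0 (Iff \<alpha> \<beta>)"
| "Delta0 \<alpha> \<Longrightarrow> x \<notin> vars_tm s \<Longrightarrow> Delta0 (All x (Imp (Leq (Var x) s) \<alpha>))"
| "Delta0 \<alpha> \<Longrightarrow> x \<notin> vars_tm s \<Longrightarrow> Delta0 (Ex x (Conj (Leq (Var x) s) \<alpha>))"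
| "Delta0 \<alpha> \<Longrightarrow> x \<notin> vars_tm s \<Longrightarrow> Delta0 (All x (Imp (Less (Var x) s) \<alpha>))"
| "Delta0 \<alpha> \<Longrightarrow> x \<notin> vars_tm s \<Longrightarrow> Delta0 (Ex x (Conj (Less (Var x) s) \<alpha>))"

definition Sigma1 :: "fm \<Rightarrow> bool" where
  "Sigma1 \<alpha> \<longleftrightarrow> (\<exists>i \<mu>. \<alpha> = Ex i \<mu> \<and> Delta0 \<mu>)"


section \<open>Naming numbers, and the unprovable sentence\<close>

definition names :: "fm set \<Rightarrow> fm \<Rightarrow> nat \<Rightarrow> bool" where
  "names T \<mu> i \<longleftrightarrow> fv \<mu> \<subseteq> {0} \<and> T \<turnstile> All 0 (Iff \<mu> (Eq (Var 0) (num i)))"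

definition bounds_goedel :: "(nat \<Rightarrow> nat) \<Rightarrow> bool" where
  "bounds_goedel g \<longleftrightarrow> (\<forall>\<mu> j. vars_fm \<mu> \<subseteq> {..<j} \<and> len_fm \<mu> < j \<longrightarrow> goedel \<mu> < g j)"

definition \<B> :: "fm set \<Rightarrow> (nat \<Rightarrow> nat) \<Rightarrow> (nat \<times> nat) set" where
  "\<B> T g = {(i, j). \<exists>\<mu>. goedel \<mu> < g j \<and> len_fm \<mu> < j \<and> names T \<mu> i}"

text \<open>$\psi(v_0,v_1)$ for a given $\varphi(v_0,v_1)$; the substitution of $v_2$ for $v_0$ has the
  intended meaning only if \<open>free_for (Var 2) 0 \<phi>\<close>.\<close>

definition psi :: "fm \<Rightarrow> fm" where
  "psi \<phi> = Conj (Neg \<phi>) (All 2 (Imp (Less (Var 2) (Var 0)) (subst_fm 0 (Var 2) \<phi>)))"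

definition psi_inst :: "fm \<Rightarrow> tm \<Rightarrow> tm \<Rightarrow> fm" where
  "psi_inst \<phi> s u = subst_fm 1 u (subst_fm 0 s (psi \<phi>))"

definition boolos_term :: "nat \<Rightarrow> tm" where
  "boolos_term k = Times (num 10) (Times (num k) (num k))"

definition least_unnamed :: "fm set \<Rightarrow> nat \<Rightarrow> nat" where
  "least_unnamed T j = (LEAST i. \<not> (\<exists>\<mu>. len_fm \<mu> < j \<and> names T \<mu> i))"

end

(* This is Boolos' form of the Berry paradox. If T proved psi(n,t), then, because Q decides the
   order between n and an arbitrary x, the formula psi(v0,t) would name n; but t abbreviates the
   large number 10 k^2 by a term of length only 2k + 19, so psi(v0,t) is shorter than 10 k^2,
   contrary to the choice of n. For the truth of psi(n,t) one has to know that a name can be taken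
   with all variables among the first 10 k^2 ones: bound variables beyond these are renamed, one at
   a time, to ones that do not occur, without changing the length. Hence there are only finitely
   many names to consider, and each of them is counted by the relation B. *)

theory Submission
  imports Defs
begin

section \<open>Substitution\<close>

lemma subst_tm_id: "x \<notin> vars_tm u \<Longrightarrow> subst_tm x s u = u"
  by (induction u) auto

lemma subst_fm_id: "x \<notin> fv \<alpha> \<Longrightarrow> subst_fm x s \<alpha> = \<alpha>"
  by (induction \<alpha>) (auto simp: subst_tm_id)

lemma subst_tm_Var_same [simp]: "subst_tm x (Var x) u = u"
  by (induction u) auto

lemma subst_fm_Var_same [simp]: "subst_fm x (Var x) \<alpha> = \<alpha>"
  by (induction \<alpha>) auto

lemma subst_tm_commute:
  "x \<noteq> y \<Longrightarrow> x \<notin> vars_tm u \<Longrightarrow> y \<notin> vars_tm s \<Longrightarrow>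
    subst_tm x s (subst_tm y u w) = subst_tm y u (subst_tm x s w)"
  by (induction w) (auto simp: subst_tm_id)

lemma subst_fm_commute:
  "x \<noteq> y \<Longrightarrow> x \<notin> vars_tm u \<Longrightarrow> y \<notin> vars_tm s \<Longrightarrow>
    subst_fm x s (subst_fm y u \<alpha>) = subst_fm y u (subst_fm x s \<alpha>)"
  by (induction \<alpha>) (auto simp: subst_tm_commute)

lemma vars_tm_subst:
  "vars_tm (subst_tm x s u) = (vars_tm u - {x}) \<union> (if x \<in> vars_tm u then vars_tm s else {})"
  by (induction u) auto

lemma fv_subst_closed: "vars_tm s = {} \<Longrightarrow> fv (subst_fm x s \<alpha>) = fv \<alpha> - {x}"
  by (induction \<alpha>) (auto simp: vars_tm_subst)

lemma fv_subst_Var: "fv (subst_fm x (Var y) \<alpha>) \<subseteq> insert y (fv \<alpha> - {x})"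
  by (induction \<alpha>) (auto simp: vars_tm_subst split: if_splits)

lemma subst_tm_Var_subst:
  "y \<notin> vars_tm u \<Longrightarrow> subst_tm y s (subst_tm x (Var y) u) = subst_tm x s u"
  by (induction u) auto

text \<open>Since \<open>y\<close> was not free and none of its new copies is captured, the free
  occurrences of \<open>y\<close> after the first step are exactly the former ones of
  \<open>x\<close>. This undoes a change of bound variable and instantiates the quantifier over
  \<open>v_2\<close> in \<open>psi\<close>.\<close>

lemma subst_fm_Var_subst:
  "y \<notin> fv \<alpha> \<Longrightarrow> free_for (Var y) x \<alpha> \<Longrightarrow>
    subst_fm y s (subst_fm x (Var y) \<alpha>) = subst_fm x s \<alpha>"
  by (induction \<alpha>) (auto simp: subst_tm_Var_subst subst_fm_id subst_tm_id)

lemma free_for_vacuous: "x \<notin> fv \<alpha> \<Longrightarrow> free_for s x \<alpha>"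
  by (induction \<alpha>) auto

lemma free_for_Var_subst:
  "y \<notin> fv \<alpha> \<Longrightarrow> free_for (Var y) x \<alpha> \<Longrightarrow> free_for s x \<alpha> \<Longrightarrow>
    free_for s y (subst_fm x (Var y) \<alpha>)"
proof (induction \<alpha>)
  case (All z \<alpha>)
  then show ?case
    by (cases "x \<in> fv (All z \<alpha>)") (auto simp: subst_fm_id free_for_vacuous)
next
  case (Ex z \<alpha>)
  then show ?case
    by (cases "x \<in> fv (Ex z \<alpha>)") (auto simp: subst_fm_id free_for_vacuous)
qed auto

lemma free_for_closed: "vars_tm s = {} \<Longrightarrow> free_for s x \<alpha>"
  by (induction \<alpha>) auto

lemma free_for_Var_same [simp]: "free_for (Var x) x \<alpha>"
  by (induction \<alpha>) auto

lemma fv_subset_vars_fm: "fv \<alpha> \<subseteq> vars_fm \<alpha>"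
  by (induction \<alpha>) auto

lemma free_for_Var_fresh: "y \<notin> vars_fm \<alpha> \<Longrightarrow> free_for (Var y) x \<alpha>"
  by (induction \<alpha>) auto

lemma free_for_subst_closed:
  "vars_tm s = {} \<Longrightarrow> free_for u x \<alpha> \<Longrightarrow> free_for u x (subst_fm y s \<alpha>)"
  by (induction \<alpha>) (auto simp: fv_subst_closed)

lemma vars_tm_num [simp]: "vars_tm (num i) = {}"
  by (induction i) auto

lemma subst_tm_num [simp]: "subst_tm x s (num i) = num i"
  by (simp add: subst_tm_id)

lemma finite_vars_tm [simp]: "finite (vars_tm s)"
  by (induction s) auto

section \<open>Substitution and truth in the standard model\<close>

lemma val_subst_tm: "val e (subst_tm x s u) = val (e(x := val e s)) u"
  by (induction u) auto

lemma val_cong: "(\<And>i. i \<in> vars_tm u \<Longrightarrow> e i = e' i) \<Longrightarrow> val e u = val e' u"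
  by (induction u) auto

lemma sat_cong: "(\<And>i. i \<in> fv \<alpha> \<Longrightarrow> e i = e' i) \<Longrightarrow> sat e \<alpha> = sat e' \<alpha>"
proof (induction \<alpha> arbitrary: e e')
  case (Eq s u)
  then show ?case using val_cong[of s e e'] val_cong[of u e e'] by auto
next
  case (Leq s u)
  then show ?case using val_cong[of s e e'] val_cong[of u e e'] by auto
next
  case (Neg \<alpha>)
  then show ?case by (metis fv.simps(3) sat.simps(3))
next
  case (Conj \<alpha> \<beta>)
  then show ?case by (metis UnCI fv.simps(4) sat.simps(4))
next
  case (Disj \<alpha> \<beta>)
  then show ?case by (metis UnCI fv.simps(5) sat.simps(5))
next
  case (Imp \<alpha> \<beta>)
  then show ?case by (metis UnCI fv.simps(6) sat.simps(6))
next
  case (Iff \<alpha> \<beta>)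
  then show ?case by (metis UnCI fv.simps(7) sat.simps(7))
next
  case (All x \<alpha>)
  have "sat (e(x := a)) \<alpha> = sat (e'(x := a)) \<alpha>" for a
    by (rule All.IH) (use All.prems in auto)
  then show ?case by simp
next
  case (Ex x \<alpha>)
  have "sat (e(x := a)) \<alpha> = sat (e'(x := a)) \<alpha>" for a
    by (rule Ex.IH) (use Ex.prems in auto)
  then show ?case by simp
qed

lemma sat_subst_fm:
  "free_for s x \<alpha> \<Longrightarrow> sat e (subst_fm x s \<alpha>) = sat (e(x := val e s)) \<alpha>"
proof (induction \<alpha> arbitrary: e)
  case (All y \<alpha>)
  show ?case
  proof (cases "x \<in> fv (All y \<alpha>)")
    case True
    then have y: "y \<noteq> x" "y \<notin> vars_tm s" "free_for s x \<alpha>" using All.prems by auto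
    have v: "val (e(y := a)) s = val e s" for a
      by (rule val_cong) (use y in auto)
    have "sat (e(y := a)) (subst_fm x s \<alpha>) = sat (e(x := val e s, y := a)) \<alpha>" for a
      by (simp only: All.IH[OF y(3)] v fun_upd_twist[OF y(1)])
    then show ?thesis using y(1) by (simp only: subst_fm.simps sat.simps if_False)
  next
    \<comment> \<open>Here \<open>free_for\<close> says nothing about \<open>y\<close>, but the
      substitution and the update of \<open>e\<close> at \<open>x\<close> both have no
      effect.\<close>
    case False
    have "sat (e(x := val e s)) (All y \<alpha>) = sat e (All y \<alpha>)"
      by (rule sat_cong) (use False in auto)
    then show ?thesis using False subst_fm_id by metis
  qed
next
  case (Ex y \<alpha>)
  show ?case
  proof (cases "x \<in> fv (Ex y \<alpha>)")
    case True
    then have y: "y \<noteq> x" "y \<notin> vars_tm s" "free_for s x \<alpha>" using Ex.prems by auto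
    have v: "val (e(y := a)) s = val e s" for a
      by (rule val_cong) (use y in auto)
    have "sat (e(y := a)) (subst_fm x s \<alpha>) = sat (e(x := val e s, y := a)) \<alpha>" for a
      by (simp only: Ex.IH[OF y(3)] v fun_upd_twist[OF y(1)])
    then show ?thesis using y(1) by (simp only: subst_fm.simps sat.simps if_False)
  next
    case False
    have "sat (e(x := val e s)) (Ex y \<alpha>) = sat e (Ex y \<alpha>)"
      by (rule sat_cong) (use False in auto)
    then show ?thesis using False subst_fm_id by metis
  qed
qed (auto simp: val_subst_tm)

lemma val_num [simp]: "val e (num i) = i"
  by (induction i) auto


section \<open>Derived rules of the calculus\<close>

lemma proves_taut: "(\<And>V. prop_eval V \<alpha>) \<Longrightarrow> T \<turnstile> \<alpha>"
  by (simp add: proves.logical logical_axiom.taut tautology_def)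

text \<open>As every tautology is an axiom, a propositional consequence is reduced to evaluating
  both sides under \<open>V\<close>; the two- and three-premise versions detach the premises one
  after another.\<close>

lemma proves_taut1:
  "T \<turnstile> \<alpha> \<Longrightarrow> (\<And>V. prop_eval V \<alpha> \<Longrightarrow> prop_eval V \<gamma>) \<Longrightarrow> T \<turnstile> \<gamma>"
  by (rule proves.mp[OF proves_taut]) auto

lemma proves_taut2:
  "T \<turnstile> \<alpha> \<Longrightarrow> T \<turnstile> \<beta> \<Longrightarrow>
    (\<And>V. prop_eval V \<alpha> \<Longrightarrow> prop_eval V \<beta> \<Longrightarrow> prop_eval V \<gamma>) \<Longrightarrow> T \<turnstile> \<gamma>"
  by (rule proves.mp[OF proves_taut1[of T \<alpha> "Imp \<beta> \<gamma>"]]) simp_all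

lemma proves_taut3:
  "T \<turnstile> \<alpha> \<Longrightarrow> T \<turnstile> \<beta> \<Longrightarrow> T \<turnstile> \<delta> \<Longrightarrow>
    (\<And>V. prop_eval V \<alpha> \<Longrightarrow> prop_eval V \<beta> \<Longrightarrow> prop_eval V \<delta> \<Longrightarrow> prop_eval V \<gamma>) \<Longrightarrow>
    T \<turnstile> \<gamma>"
  by (rule proves.mp[OF proves_taut2[of T \<alpha> \<beta> "Imp \<delta> \<gamma>"]]) simp_all

lemma proves_conj: "T \<turnstile> \<alpha> \<Longrightarrow> T \<turnstile> \<beta> \<Longrightarrow> T \<turnstile> Conj \<alpha> \<beta>"
  by (rule proves_taut2) auto

lemma proves_inst: "free_for s x \<alpha> \<Longrightarrow> T \<turnstile> All x \<alpha> \<Longrightarrow> T \<turnstile> subst_fm x s \<alpha>"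
  by (rule proves.mp[OF proves.logical[OF logical_axiom.inst]])

lemma proves_All_Var: "T \<turnstile> All x \<alpha> \<Longrightarrow> T \<turnstile> \<alpha>"
  using proves_inst[of "Var x" x \<alpha>] by simp

lemma proves_refl: "T \<turnstile> Eq s s"
  by (rule proves.logical[OF logical_axiom.eq_refl])

lemma proves_eq_subst:
  "free_for s x \<alpha> \<Longrightarrow> free_for u x \<alpha> \<Longrightarrow>
    T \<turnstile> Imp (Eq s u) (Imp (subst_fm x s \<alpha>) (subst_fm x u \<alpha>))"
  by (rule proves.logical[OF logical_axiom.eq_subst])

text \<open>Leibniz's law for the formula \<open>Eq (Var x) s\<close>, where \<open>x\<close> is
  fresh for \<open>s\<close> so that only the left-hand side is replaced.\<close>

lemma proves_sym: "T \<turnstile> Imp (Eq s u) (Eq u s)"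
proof -
  obtain x where "x \<notin> vars_tm s" by (meson ex_new_if_finite finite_vars_tm infinite_UNIV_nat)
  then have "T \<turnstile> Imp (Eq s u) (Imp (Eq s s) (Eq u s))"
    using proves_eq_subst[of s x "Eq (Var x) s" u T] by (simp add: subst_tm_id)
  then show ?thesis by (rule proves_taut2[OF _ proves_refl[of T s]]) auto
qed

lemma proves_trans: "T \<turnstile> Imp (Eq s u) (Imp (Eq u w) (Eq s w))"
proof -
  obtain x where "x \<notin> vars_tm s" by (meson ex_new_if_finite finite_vars_tm infinite_UNIV_nat)
  then have "T \<turnstile> Imp (Eq u w) (Imp (Eq s u) (Eq s w))"
    using proves_eq_subst[of u x "Eq s (Var x)" w T] by (simp add: subst_tm_id)
  then show ?thesis by (rule proves_taut1) auto
qed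

lemma proves_Succ_cong: "T \<turnstile> Imp (Eq s u) (Eq (Succ s) (Succ u))"
proof -
  obtain x where "x \<notin> vars_tm s" by (meson ex_new_if_finite finite_vars_tm infinite_UNIV_nat)
  then have "T \<turnstile> Imp (Eq s u) (Imp (Eq (Succ s) (Succ s)) (Eq (Succ s) (Succ u)))"
    using proves_eq_subst[of s x "Eq (Succ s) (Succ (Var x))" u T] by (simp add: subst_tm_id)
  then show ?thesis by (rule proves_taut2[OF _ proves_refl[of T "Succ s"]]) auto
qed

lemma proves_Ex_witness: "free_for s x \<alpha> \<Longrightarrow> T \<turnstile> Imp (subst_fm x s \<alpha>) (Ex x \<alpha>)"
  by (rule proves_taut2[OF
        proves.logical[OF logical_axiom.inst[of s x "Neg \<alpha>"]]
        proves.logical[OF logical_axiom.ex_all[of x \<alpha>]]]) auto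

locale sentence_theory =
  fixes T :: "fm set"
  assumes sentences: "\<forall>\<alpha>\<in>T. sentence \<alpha>"
begin

text \<open>Generalization is not a rule of the calculus, so it is shown by induction on
  derivations: hypotheses are sentences, hence \<open>vac\<close> applies; axioms are closed under
  \<open>gen\<close>; \<open>dist\<close> carries modus ponens through the quantifier.\<close>

lemma proves_gen: "T \<turnstile> \<alpha> \<Longrightarrow> T \<turnstile> All x \<alpha>"
proof (induction rule: proves.induct)
  case (hyp \<alpha>)
  then have "x \<notin> fv \<alpha>" using sentences by (auto simp: sentence_def)
  then show ?case
    using hyp proves.mp[OF proves.logical[OF logical_axiom.vac]] proves.hyp by blast
next
  case (logical \<alpha>)
  then show ?case using logical_axiom.gen proves.logical by blast
next
  case (mp \<alpha> \<beta>)
  then show ?case by (meson logical_axiom.dist proves.simps)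
qed

lemma proves_subst: "T \<turnstile> \<alpha> \<Longrightarrow> free_for s x \<alpha> \<Longrightarrow> T \<turnstile> subst_fm x s \<alpha>"
  using proves_gen proves_inst by blast

lemma proves_All_mono: "T \<turnstile> Imp \<alpha> \<beta> \<Longrightarrow> T \<turnstile> Imp (All x \<alpha>) (All x \<beta>)"
  using proves_gen proves.mp[OF proves.logical[OF logical_axiom.dist]] by blast

lemma proves_All_intro: "T \<turnstile> Imp \<alpha> \<beta> \<Longrightarrow> x \<notin> fv \<alpha> \<Longrightarrow> T \<turnstile> Imp \<alpha> (All x \<beta>)"
  by (rule proves_taut2[OF proves_All_mono[of \<alpha> \<beta> x] proves.logical[OF logical_axiom.vac]]) auto

lemma proves_Ex_elim:
  assumes "T \<turnstile> Imp \<alpha> \<beta>" "x \<notin> fv \<beta>"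
  shows "T \<turnstile> Imp (Ex x \<alpha>) \<beta>"
proof -
  have "T \<turnstile> Imp (Neg \<beta>) (Neg \<alpha>)" using assms(1) by (rule proves_taut1) auto
  then have "T \<turnstile> Imp (Neg \<beta>) (All x (Neg \<alpha>))" by (rule proves_All_intro) (use assms in auto)
  then show ?thesis
    by (rule proves_taut2[OF _ proves.logical[OF logical_axiom.ex_all[of x \<alpha>]]]) auto
qed

lemma proves_Ex_mono:
  assumes "T \<turnstile> Imp \<alpha> \<beta>"
  shows "T \<turnstile> Imp (Ex x \<alpha>) (Ex x \<beta>)"
proof (rule proves_Ex_elim)
  have "T \<turnstile> Imp \<beta> (Ex x \<beta>)" using proves_Ex_witness[of "Var x" x \<beta> T] by simp
  with assms show "T \<turnstile> Imp \<alpha> (Ex x \<beta>)" by (rule proves_taut2) auto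
qed auto

lemma proves_All_cong: "T \<turnstile> Iff \<alpha> \<beta> \<Longrightarrow> T \<turnstile> Iff (All x \<alpha>) (All x \<beta>)"
  by (rule proves_taut2[OF
        proves_All_mono[OF proves_taut1[of T "Iff \<alpha> \<beta>" "Imp \<alpha> \<beta>"], of x]
        proves_All_mono[OF proves_taut1[of T "Iff \<alpha> \<beta>" "Imp \<beta> \<alpha>"], of x]]) auto

lemma proves_Ex_cong: "T \<turnstile> Iff \<alpha> \<beta> \<Longrightarrow> T \<turnstile> Iff (Ex x \<alpha>) (Ex x \<beta>)"
  by (rule proves_taut2[OF
        proves_Ex_mono[OF proves_taut1[of T "Iff \<alpha> \<beta>" "Imp \<alpha> \<beta>"], of x]
        proves_Ex_mono[OF proves_taut1[of T "Iff \<alpha> \<beta>" "Imp \<beta> \<alpha>"], of x]]) auto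

text \<open>Each direction instantiates and then generalizes: first at \<open>y\<close>, which is
  fresh, then back at \<open>x\<close>, which is no longer free once \<open>y\<close> has replaced
  it.\<close>

lemma proves_All_alpha:
  assumes "y \<notin> vars_fm \<alpha>"
  shows "T \<turnstile> Iff (All x \<alpha>) (All y (subst_fm x (Var y) \<alpha>))"
proof -
  let ?\<beta> = "subst_fm x (Var y) \<alpha>"
  have y: "y \<notin> fv \<alpha>" using assms fv_subset_vars_fm by blast
  note free = free_for_Var_fresh[OF assms]
  have x: "x \<notin> fv (All y ?\<beta>)" using fv_subst_Var[of x y \<alpha>] by auto
  have "T \<turnstile> Imp (All x \<alpha>) ?\<beta>" by (rule proves.logical[OF logical_axiom.inst[OF free]])
  then have 1: "T \<turnstile> Imp (All x \<alpha>) (All y ?\<beta>)" by (rule proves_All_intro) (use y in auto)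
  have "T \<turnstile> Imp (All y ?\<beta>) \<alpha>"
    using proves.logical[OF logical_axiom.inst[of "Var x" y ?\<beta>]]
    by (simp add: free_for_Var_subst subst_fm_Var_subst y free)
  then have 2: "T \<turnstile> Imp (All y ?\<beta>) (All x \<alpha>)" by (rule proves_All_intro) (rule x)
  show ?thesis using 1 2 by (rule proves_taut2) auto
qed

lemma proves_Ex_alpha:
  assumes "y \<notin> vars_fm \<alpha>"
  shows "T \<turnstile> Iff (Ex x \<alpha>) (Ex y (subst_fm x (Var y) \<alpha>))"
  by (rule proves_taut3[OF proves_All_alpha[of y "Neg \<alpha>" x]
        proves.logical[OF logical_axiom.ex_all[of x \<alpha>]]
        proves.logical[OF logical_axiom.ex_all[of y "subst_fm x (Var y) \<alpha>"]]])
    (use assms in auto)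

end


section \<open>Renaming bound variables\<close>

text \<open>In contrast to \<open>subst_fm\<close>, bound occurrences and the quantifiers themselves
  are changed too. For distinct \<open>x\<close> and \<open>y\<close> this removes \<open>x\<close>
  from the formula altogether, at no cost in length.\<close>

fun rename_fm :: "nat \<Rightarrow> nat \<Rightarrow> fm \<Rightarrow> fm" where
  "rename_fm x y (Eq s u) = Eq (subst_tm x (Var y) s) (subst_tm x (Var y) u)"
| "rename_fm x y (Leq s u) = Leq (subst_tm x (Var y) s) (subst_tm x (Var y) u)"
| "rename_fm x y (Neg \<alpha>) = Neg (rename_fm x y \<alpha>)"
| "rename_fm x y (Conj \<alpha> \<beta>) = Conj (rename_fm x y \<alpha>) (rename_fm x y \<beta>)"
| "rename_fm x y (Disj \<alpha> \<beta>) = Disj (rename_fm x y \<alpha>) (rename_fm x y \<beta>)"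
| "rename_fm x y (Imp \<alpha> \<beta>) = Imp (rename_fm x y \<alpha>) (rename_fm x y \<beta>)"
| "rename_fm x y (Iff \<alpha> \<beta>) = Iff (rename_fm x y \<alpha>) (rename_fm x y \<beta>)"
| "rename_fm x y (All z \<alpha>) = All (if z = x then y else z) (rename_fm x y \<alpha>)"
| "rename_fm x y (Ex z \<alpha>) = Ex (if z = x then y else z) (rename_fm x y \<alpha>)"

lemma length_str_tm_rename [simp]: "length (str_tm (subst_tm x (Var y) s)) = length (str_tm s)"
  by (induction s) auto

lemma len_rename_fm [simp]: "len_fm (rename_fm x y \<alpha>) = len_fm \<alpha>"
  unfolding len_fm_def by (induction \<alpha>) auto

lemma vars_tm_rename:
  "vars_tm (subst_tm x (Var y) s) = (\<lambda>z. if z = x then y else z) ` vars_tm s"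
  by (induction s) auto

lemma vars_rename_fm:
  "vars_fm (rename_fm x y \<alpha>) = (\<lambda>z. if z = x then y else z) ` vars_fm \<alpha>"
  by (induction \<alpha>) (auto simp: vars_tm_rename image_Un)

lemma fv_rename_fm:
  assumes "y \<notin> vars_fm \<alpha>"
  shows "fv (rename_fm x y \<alpha>) = (\<lambda>z. if z = x then y else z) ` fv \<alpha>"
  using assms
proof (induction \<alpha>)
  case (All z \<alpha>)
  then have "y \<notin> fv \<alpha>" using fv_subset_vars_fm[of \<alpha>] by auto
  with All show ?case by (auto simp: image_iff)
next
  case (Ex z \<alpha>)
  then have "y \<notin> fv \<alpha>" using fv_subset_vars_fm[of \<alpha>] by auto
  with Ex show ?case by (auto simp: image_iff)
qed (auto simp: vars_tm_rename image_Un)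

context sentence_theory
begin

text \<open>The two formulas differ only where \<open>x\<close> is bound. At a quantifier over
  \<open>x\<close>, \<open>subst_fm\<close> stops; a change of bound variable to \<open>y\<close>
  then produces the substituted body, to which the induction hypothesis applies.\<close>

lemma proves_subst_iff_rename:
  "y \<notin> vars_fm \<alpha> \<Longrightarrow> T \<turnstile> Iff (subst_fm x (Var y) \<alpha>) (rename_fm x y \<alpha>)"
proof (induction \<alpha>)
  case (Neg \<alpha>)
  then show ?case
    by - (rule proves_taut1[of T "Iff (subst_fm x (Var y) \<alpha>) (rename_fm x y \<alpha>)"], auto)
next
  case (Conj \<alpha> \<beta>)
  then show ?case
    by - (rule proves_taut2[of T "Iff (subst_fm x (Var y) \<alpha>) (rename_fm x y \<alpha>)"
          "Iff (subst_fm x (Var y) \<beta>) (rename_fm x y \<beta>)"], auto)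
next
  case (Disj \<alpha> \<beta>)
  then show ?case
    by - (rule proves_taut2[of T "Iff (subst_fm x (Var y) \<alpha>) (rename_fm x y \<alpha>)"
          "Iff (subst_fm x (Var y) \<beta>) (rename_fm x y \<beta>)"], auto)
next
  case (Imp \<alpha> \<beta>)
  then show ?case
    by - (rule proves_taut2[of T "Iff (subst_fm x (Var y) \<alpha>) (rename_fm x y \<alpha>)"
          "Iff (subst_fm x (Var y) \<beta>) (rename_fm x y \<beta>)"], auto)
next
  case (Iff \<alpha> \<beta>)
  then show ?case
    by - (rule proves_taut2[of T "Iff (subst_fm x (Var y) \<alpha>) (rename_fm x y \<alpha>)"
          "Iff (subst_fm x (Var y) \<beta>) (rename_fm x y \<beta>)"], auto)
next
  case (All z \<alpha>)
  then have *: "T \<turnstile> Iff (subst_fm x (Var y) \<alpha>) (rename_fm x y \<alpha>)" "y \<notin> vars_fm \<alpha>" by auto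
  show ?case
  proof (cases "z = x")
    case True
    have "T \<turnstile> Iff (All x \<alpha>) (All y (rename_fm x y \<alpha>))"
      by (rule proves_taut2[OF proves_All_alpha[OF *(2), of x] proves_All_cong[OF *(1), of y]]) auto
    with True show ?thesis by simp
  next
    case False
    then show ?thesis using proves_All_cong[OF *(1)] by simp
  qed
next
  case (Ex z \<alpha>)
  then have *: "T \<turnstile> Iff (subst_fm x (Var y) \<alpha>) (rename_fm x y \<alpha>)" "y \<notin> vars_fm \<alpha>" by auto
  show ?case
  proof (cases "z = x")
    case True
    have "T \<turnstile> Iff (Ex x \<alpha>) (Ex y (rename_fm x y \<alpha>))"
      by (rule proves_taut2[OF proves_Ex_alpha[OF *(2), of x] proves_Ex_cong[OF *(1), of y]]) auto
    with True show ?thesis by simp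
  next
    case False
    then show ?thesis using proves_Ex_cong[OF *(1)] by simp
  qed
qed (simp_all add: proves_taut)

lemma names_rename_fm:
  assumes "names T \<mu> i" "x \<notin> fv \<mu>" "y \<notin> vars_fm \<mu>"
  shows "names T (rename_fm x y \<mu>) i"
proof -
  have "T \<turnstile> Iff \<mu> (rename_fm x y \<mu>)"
    using proves_subst_iff_rename[OF assms(3), of x] assms(2) by (simp add: subst_fm_id)
  moreover have "T \<turnstile> Iff \<mu> (Eq (Var 0) (num i))"
    using assms(1) proves_All_Var by (auto simp: names_def)
  ultimately have "T \<turnstile> Iff (rename_fm x y \<mu>) (Eq (Var 0) (num i))"
    by (rule proves_taut2) auto
  moreover have "fv (rename_fm x y \<mu>) = fv \<mu>"
    using assms(2) by (force simp: fv_rename_fm[OF assms(3)])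
  ultimately show ?thesis using assms(1) proves_gen by (simp add: names_def)
qed

end

section \<open>Names using only the first \<open>j\<close> variables\<close>

lemma finite_vars_fm [simp]: "finite (vars_fm \<alpha>)"
  by (induction \<alpha>) auto

lemma vars_tm_eq_str: "vars_tm s = {i. VarS i \<in> set (str_tm s)}"
  by (induction s) auto

lemma vars_fm_eq_str: "vars_fm \<alpha> = {i. VarS i \<in> set (str_fm \<alpha>)}"
  by (induction \<alpha>) (auto simp: vars_tm_eq_str)

text \<open>This is where it matters that a variable counts as one symbol whatever its index:
  distinct variables are distinct symbols of the string.\<close>

lemma card_vars_fm_le: "card (vars_fm \<alpha>) \<le> len_fm \<alpha>"
proof -
  have "card (vars_fm \<alpha>) = card (VarS ` vars_fm \<alpha>)"
    by (simp add: card_image inj_on_def)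
  also have "\<dots> \<le> card (set (str_fm \<alpha>))"
    by (rule card_mono) (auto simp: vars_fm_eq_str)
  also have "\<dots> \<le> len_fm \<alpha>" by (simp add: len_fm_def card_length)
  finally show ?thesis .
qed

lemma (in sentence_theory) names_bounded_vars:
  assumes "names T \<mu> i" "len_fm \<mu> < j"
  shows "\<exists>\<mu>'. vars_fm \<mu>' \<subseteq> {..<j} \<and> len_fm \<mu>' < j \<and> names T \<mu>' i"
  using assms
proof (induction "card (vars_fm \<mu> - {..<j})" arbitrary: \<mu> rule: less_induct)
  case less
  show ?case
  proof (cases "vars_fm \<mu> \<subseteq> {..<j}")
    case True
    then show ?thesis using less.prems by blast
  next
    case False
    then obtain x where x: "x \<in> vars_fm \<mu>" "\<not> x < j" by auto
    \<comment> \<open>\<open>j\<close> exceeds a length, so it is positive and \<open>v_0\<close>,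
      the only variable that may be free, is among the first \<open>j\<close>.\<close>
    then have x_fv: "x \<notin> fv \<mu>" using less.prems by (auto simp: names_def)
    \<comment> \<open>Pigeonhole: a formula shorter than \<open>j\<close> cannot contain all of the
      first \<open>j\<close> variables.\<close>
    have "\<not> {..<j} \<subseteq> vars_fm \<mu>"
    proof
      assume "{..<j} \<subseteq> vars_fm \<mu>"
      then have "j \<le> card (vars_fm \<mu>)" using card_mono[of "vars_fm \<mu>" "{..<j}"] by simp
      then show False using card_vars_fm_le[of \<mu>] less.prems by simp
    qed
    then obtain y where y: "y < j" "y \<notin> vars_fm \<mu>" by auto
    have "vars_fm (rename_fm x y \<mu>) - {..<j} \<subset> vars_fm \<mu> - {..<j}"
      using x y by (auto simp: vars_rename_fm split: if_splits)
    then have "card (vars_fm (rename_fm x y \<mu>) - {..<j}) < card (vars_fm \<mu> - {..<j})"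
      by (intro psubset_card_mono) auto
    then show ?thesis
      using less.hyps names_rename_fm[OF less.prems(1) x_fv y(2)] less.prems(2) by simp
  qed
qed


section \<open>Finiteness of the set of short formulas\<close>

text \<open>A compound term is longer than its parts, so those of length at most
  \<open>Suc m\<close> arise by one constructor from those of length at most \<open>m\<close>. The
  variables are confined to \<open>X\<close> because infinitely many of them have length
  one.\<close>

lemma finite_short_tms:
  assumes "finite X"
  shows "finite {s. vars_tm s \<subseteq> X \<and> length (str_tm s) \<le> m}"
proof (induction m)
  case 0
  have "str_tm s \<noteq> []" for s by (cases s) auto
  then show ?case by simp
next
  case (Suc m)
  let ?A = "{s. vars_tm s \<subseteq> X \<and> length (str_tm s) \<le> m}"
  have "{s. vars_tm s \<subseteq> X \<and> length (str_tm s) \<le> Suc m} \<subseteq>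
      insert Zero (Var ` X) \<union> Succ ` ?A
        \<union> (\<lambda>(s, u). Plus s u) ` (?A \<times> ?A) \<union> (\<lambda>(s, u). Times s u) ` (?A \<times> ?A)"
    (is "?L \<subseteq> ?R")
  proof
    fix s assume "s \<in> ?L" then show "s \<in> ?R" by (cases s) auto
  qed
  moreover have "finite ?R" using Suc assms by simp
  ultimately show ?case by (rule finite_subset)
qed

lemma finite_short_fms:
  assumes "finite X"
  shows "finite {\<alpha>. vars_fm \<alpha> \<subseteq> X \<and> len_fm \<alpha> \<le> m}"
proof (induction m)
  case 0
  have "str_fm \<alpha> \<noteq> []" for \<alpha> by (cases \<alpha>) auto
  then show ?case by (simp add: len_fm_def)
next
  case (Suc m)
  let ?A = "{s. vars_tm s \<subseteq> X \<and> length (str_tm s) \<le> m}"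
  let ?B = "{\<alpha>. vars_fm \<alpha> \<subseteq> X \<and> len_fm \<alpha> \<le> m}"
  have "{\<alpha>. vars_fm \<alpha> \<subseteq> X \<and> len_fm \<alpha> \<le> Suc m} \<subseteq>
      (\<lambda>(s, u). Eq s u) ` (?A \<times> ?A) \<union> (\<lambda>(s, u). Leq s u) ` (?A \<times> ?A) \<union> Neg ` ?B
        \<union> (\<lambda>(\<alpha>, \<beta>). Conj \<alpha> \<beta>) ` (?B \<times> ?B) \<union> (\<lambda>(\<alpha>, \<beta>). Disj \<alpha> \<beta>) ` (?B \<times> ?B)
        \<union> (\<lambda>(\<alpha>, \<beta>). Imp \<alpha> \<beta>) ` (?B \<times> ?B) \<union> (\<lambda>(\<alpha>, \<beta>). Iff \<alpha> \<beta>) ` (?B \<times> ?B)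
        \<union> (\<lambda>(x, \<alpha>). All x \<alpha>) ` (X \<times> ?B) \<union> (\<lambda>(x, \<alpha>). Ex x \<alpha>) ` (X \<times> ?B)"
    (is "?L \<subseteq> ?R")
  proof
    fix \<alpha> assume "\<alpha> \<in> ?L" then show "\<alpha> \<in> ?R" by (cases \<alpha>) (auto simp: len_fm_def)
  qed
  moreover have "finite ?R" using Suc assms finite_short_tms[OF assms] by simp
  ultimately show ?case by (rule finite_subset)
qed


section \<open>Arithmetic in extensions of Q\<close>

locale arith_theory = sentence_theory +
  assumes ext_Q: "extends_Q T"
begin

lemma Q_Succ_neq_Zero: "T \<turnstile> Neg (Eq (Succ (Var 0)) Zero)"
  and Q_Succ_inj:
    "T \<turnstile> Imp (Eq (Succ (Var 0)) (Succ (Var 1))) (Eq (Var 0) (Var 1))"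
  and Q_pred: "T \<turnstile> Imp (Neg (Eq (Var 0) Zero)) (Ex 1 (Eq (Var 0) (Succ (Var 1))))"
  and Q_Plus_Zero: "T \<turnstile> Eq (Plus (Var 0) Zero) (Var 0)"
  and Q_Plus_Succ:
    "T \<turnstile> Eq (Plus (Var 0) (Succ (Var 1))) (Succ (Plus (Var 0) (Var 1)))"
  and Q_Leq: "T \<turnstile> Iff (Leq (Var 0) (Var 1)) (Ex 2 (Eq (Plus (Var 2) (Var 0)) (Var 1)))"
  using ext_Q unfolding extends_Q_def Q_axioms_def
  by (meson insertI1 insertI2 proves_All_Var)+

text \<open>Injectivity of the successor peels both numerals until one of them is zero.\<close>

lemma proves_num_neq: "i \<noteq> j \<Longrightarrow> T \<turnstile> Neg (Eq (num i) (num j))"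
proof (induction i arbitrary: j)
  case 0
  then obtain j' where j: "j = Suc j'" using not0_implies_Suc by auto
  have "T \<turnstile> Neg (Eq (num j) Zero)"
    using proves_subst[OF Q_Succ_neq_Zero, of "num j'" 0] j by simp
  then show ?case by (rule proves_taut2[OF _ proves_sym[of T Zero "num j"]]) auto
next
  case (Suc i)
  show ?case
  proof (cases j)
    case 0
    then show ?thesis using proves_subst[OF Q_Succ_neq_Zero, of "num i" 0] by simp
  next
    case (Suc j')
    have "T \<turnstile> Imp (Eq (num (Suc i)) (num j)) (Eq (num i) (num j'))"
      using proves_subst[OF proves_subst[OF Q_Succ_inj, of "num i" 0], of "num j'" 1] Suc
      by simp
    then show ?thesis
      by (rule proves_taut2[OF _ Suc.IH[of j']]) (use Suc Suc.prems in auto)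
  qed
qed

lemma proves_Zero_Leq: "T \<turnstile> Leq Zero (Var 0)"
proof -
  have 1: "T \<turnstile> Iff (Leq Zero (Var 0)) (Ex 2 (Eq (Plus (Var 2) Zero) (Var 0)))"
    using proves_subst[OF proves_subst[OF Q_Leq, of Zero 0], of "Var 0" 1] by simp
  have 2: "T \<turnstile> Imp (Eq (Plus (Var 0) Zero) (Var 0)) (Ex 2 (Eq (Plus (Var 2) Zero) (Var 0)))"
    using proves_Ex_witness[of "Var 0" 2 "Eq (Plus (Var 2) Zero) (Var 0)" T] by simp
  show ?thesis using 1 2 Q_Plus_Zero by (rule proves_taut3) auto
qed

text \<open>The same witness serves both inequalities, because addition recurses on its right
  argument: \<open>z + s(x) = s(z + x)\<close>.\<close>

lemma proves_Succ_Leq_Succ: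
  "T \<turnstile> Imp (Leq (Var 0) (Var 1)) (Leq (Succ (Var 0)) (Succ (Var 1)))"
proof -
  have Leq_SS: "T \<turnstile> Iff (Leq (Succ (Var 0)) (Succ (Var 1)))
      (Ex 2 (Eq (Plus (Var 2) (Succ (Var 0))) (Succ (Var 1))))"
    using proves_subst[OF proves_subst[OF Q_Leq, of "Succ (Var 0)" 0], of "Succ (Var 1)" 1]
    by simp
  have Plus_S: "T \<turnstile> Eq (Plus (Var 2) (Succ (Var 0))) (Succ (Plus (Var 2) (Var 0)))"
    using proves_subst[OF proves_subst[OF Q_Plus_Succ, of "Var 2" 0], of "Var 0" 1] by simp
  have "T \<turnstile> Imp (Eq (Plus (Var 2) (Var 0)) (Var 1))
      (Eq (Plus (Var 2) (Succ (Var 0))) (Succ (Var 1)))"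
    by (rule proves_taut3[OF Plus_S proves_Succ_cong[of T "Plus (Var 2) (Var 0)" "Var 1"]
          proves_trans[of T "Plus (Var 2) (Succ (Var 0))" "Succ (Plus (Var 2) (Var 0))"
            "Succ (Var 1)"]]) auto
  then have "T \<turnstile> Imp (Ex 2 (Eq (Plus (Var 2) (Var 0)) (Var 1)))
      (Ex 2 (Eq (Plus (Var 2) (Succ (Var 0))) (Succ (Var 1))))"
    by (rule proves_Ex_mono)
  then show ?thesis by (rule proves_taut3[OF _ Q_Leq Leq_SS]) auto
qed

text \<open>\<open>Q\<close> has no induction scheme, so the induction is on \<open>i\<close>,
  outside the theory. Inside, \<open>v_0\<close> is either zero or a successor, and in the latter
  case the hypothesis for \<open>i\<close> is applied to its predecessor \<open>v_1\<close>.\<close>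

lemma proves_Leq_num_linear: "T \<turnstile> Disj (Leq (Var 0) (num i)) (Leq (num i) (Var 0))"
proof (induction i)
  case 0
  show ?case using proves_Zero_Leq by (rule proves_taut1) auto
next
  case (Suc i)
  let ?D = "\<lambda>s. Disj (Leq s (num (Suc i))) (Leq (num (Suc i)) s)"
  have IH: "T \<turnstile> Disj (Leq (Var 1) (num i)) (Leq (num i) (Var 1))"
    using proves_subst[OF Suc, of "Var 1" 0] by simp
  have 1: "T \<turnstile> Imp (Leq (Var 1) (num i)) (Leq (Succ (Var 1)) (num (Suc i)))"
    using proves_subst[OF proves_subst[OF proves_Succ_Leq_Succ, of "num i" 1], of "Var 1" 0]
    by simp
  have 2: "T \<turnstile> Imp (Leq (num i) (Var 1)) (Leq (num (Suc i)) (Succ (Var 1)))"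
    using proves_subst[OF proves_Succ_Leq_Succ, of "num i" 0] by simp
  have succ: "T \<turnstile> ?D (Succ (Var 1))" using IH 1 2 by (rule proves_taut3) auto
  have "T \<turnstile> Imp (Eq (Succ (Var 1)) (Var 0)) (Imp (?D (Succ (Var 1))) (?D (Var 0)))"
    using proves_eq_subst[of "Succ (Var 1)" 0 "?D (Var 0)" "Var 0" T] by simp
  then have "T \<turnstile> Imp (Eq (Var 0) (Succ (Var 1))) (?D (Var 0))"
    by (rule proves_taut3[OF _ proves_sym[of T "Var 0" "Succ (Var 1)"] succ]) auto
  then have Ex: "T \<turnstile> Imp (Ex 1 (Eq (Var 0) (Succ (Var 1)))) (?D (Var 0))"
    by (rule proves_Ex_elim) auto
  have "T \<turnstile> Leq Zero (num (Suc i))"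
    using proves_subst[OF proves_Zero_Leq, of "num (Suc i)" 0] by simp
  then have zero: "T \<turnstile> ?D Zero" by (rule proves_taut1) auto
  have "T \<turnstile> Imp (Eq Zero (Var 0)) (Imp (?D Zero) (?D (Var 0)))"
    using proves_eq_subst[of Zero 0 "?D (Var 0)" "Var 0" T] by simp
  then have "T \<turnstile> Imp (Eq (Var 0) Zero) (?D (Var 0))"
    by (rule proves_taut3[OF _ proves_sym[of T "Var 0" Zero] zero]) auto
  then show ?case by (rule proves_taut3[OF _ Ex Q_pred]) auto
qed

text \<open>Instantiating both naming statements at \<open>num i\<close> yields a proof of
  \<open>Eq (num i) (num i')\<close>, which is refutable for distinct numbers.\<close>

lemma names_unique:
  assumes "consistent T" "names T \<mu> i" "names T \<mu> i'"
  shows "i = i'"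
proof (rule ccontr)
  assume "i \<noteq> i'"
  have "T \<turnstile> Iff (subst_fm 0 (num i) \<mu>) (Eq (num i) (num i))"
    using proves_inst[of "num i" 0 "Iff \<mu> (Eq (Var 0) (num i))" T] assms(2)
    by (simp add: names_def free_for_closed)
  moreover have "T \<turnstile> Iff (subst_fm 0 (num i) \<mu>) (Eq (num i) (num i'))"
    using proves_inst[of "num i" 0 "Iff \<mu> (Eq (Var 0) (num i'))" T] assms(3)
    by (simp add: names_def free_for_closed)
  ultimately have "T \<turnstile> Eq (num i) (num i')"
    by (rule proves_taut3[OF _ _ proves_refl[of T "num i"]]) auto
  then show False using proves_num_neq[OF \<open>i \<noteq> i'\<close>] assms(1) by (auto simp: consistent_def)
qed

lemma finite_named:
  assumes "consistent T"
  shows "finite {i. \<exists>\<mu>. len_fm \<mu> < j \<and> names T \<mu> i}"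
proof -
  let ?F = "{\<mu>. vars_fm \<mu> \<subseteq> {..<j} \<and> len_fm \<mu> \<le> j}"
  \<comment> \<open>Every named number is the value of some formula in \<open>?F\<close>; on
    formulas that name nothing, \<open>THE\<close> gives an arbitrary value, which does no
    harm.\<close>
  have "{i. \<exists>\<mu>. len_fm \<mu> < j \<and> names T \<mu> i} \<subseteq> (\<lambda>\<mu>. THE i. names T \<mu> i) ` ?F"
  proof
    fix i assume "i \<in> {i. \<exists>\<mu>. len_fm \<mu> < j \<and> names T \<mu> i}"
    then obtain \<mu> where \<mu>: "vars_fm \<mu> \<subseteq> {..<j}" "len_fm \<mu> < j" "names T \<mu> i"
      using names_bounded_vars by blast
    then have "(THE i. names T \<mu> i) = i" using names_unique[OF assms] by blast
    with \<mu> show "i \<in> (\<lambda>\<mu>. THE i. names T \<mu> i) ` ?F" by force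
  qed
  then show ?thesis
    using finite_short_fms[of "{..<j}" j] by (meson finite_imageI finite_lessThan finite_subset)
qed

text \<open>The Berry step, with \<open>\<chi>\<close> standing for \<open>\<phi>(v_0,t)\<close>.
  Assume \<open>psi \<chi>\<close> of \<open>x\<close>. If \<open>x < n\<close>, provability at
  \<open>n\<close> gives \<open>\<chi>(x)\<close>; if \<open>n < x\<close>, the assumption gives
  \<open>\<chi>(n)\<close>; both are refuted. Since \<open>n\<close> and \<open>x\<close> are
  comparable, \<open>x = n\<close>.\<close>

lemma names_psi:
  assumes fv: "fv \<chi> \<subseteq> {0}" and free: "free_for (Var 2) 0 \<chi>"
    and prov: "T \<turnstile> subst_fm 0 (num n) (psi \<chi>)"
  shows "names T (psi \<chi>) n"
proof -
  let ?x = "Var 0" and ?n = "num n"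
  let ?\<chi>n = "subst_fm 0 ?n \<chi>" and ?\<chi>2 = "subst_fm 0 (Var 2) \<chi>"
  let ?inner = "\<lambda>s. Imp (Less (Var 2) s) ?\<chi>2"
  have fv2: "2 \<notin> fv \<chi>" using fv by auto
  have "0 \<notin> fv ?\<chi>2" using fv_subst_Var[of 0 2 \<chi>] by auto
  then have "subst_fm 0 ?n ?\<chi>2 = ?\<chi>2" by (rule subst_fm_id)
  then have prov': "T \<turnstile> Conj (Neg ?\<chi>n) (All 2 (?inner ?n))"
    using prov by (simp add: psi_def Less_def)
  have at_x: "T \<turnstile> Imp (All 2 (?inner ?n)) (Imp (Less ?x ?n) \<chi>)"
    using proves.logical[OF logical_axiom.inst[of ?x 2 "?inner ?n"], of T]
    by (simp add: Less_def free_for_Var_subst subst_fm_Var_subst fv2 free)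
  have at_n: "T \<turnstile> Imp (All 2 (?inner ?x)) (Imp (Less ?n ?x) ?\<chi>n)"
    using proves.logical[OF logical_axiom.inst[of ?n 2 "?inner ?x"], of T]
    by (simp add: Less_def free_for_closed subst_fm_Var_subst fv2 free)
  have 1: "T \<turnstile> Imp (psi \<chi>) (Eq ?x ?n)"
    unfolding psi_def
    by (rule proves_taut3[OF proves_conj[OF prov' proves_Leq_num_linear[of n]]
          proves_conj[OF at_x at_n] proves_sym[of T ?n ?x]]) (auto simp: Less_def)
  \<comment> \<open>The converse only replaces \<open>n\<close> by an equal in the provable
    instance.\<close>
  have "T \<turnstile> Imp (Eq ?n ?x) (Imp (subst_fm 0 ?n (psi \<chi>)) (psi \<chi>))"
    using proves_eq_subst[of ?n 0 "psi \<chi>" ?x T] by (simp add: free_for_closed)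
  then have 2: "T \<turnstile> Imp (Eq ?x ?n) (psi \<chi>)"
    by (rule proves_taut3[OF _ prov proves_sym[of T ?x ?n]]) auto
  have "T \<turnstile> Iff (psi \<chi>) (Eq ?x ?n)" using 1 2 by (rule proves_taut2) auto
  moreover have "fv (psi \<chi>) \<subseteq> {0}"
    using fv fv_subst_Var[of 0 2 \<chi>] by (auto simp: psi_def Less_def)
  ultimately show ?thesis using proves_gen by (simp add: names_def)
qed

end


section \<open>Lengths\<close>

text \<open>The lost variable symbols are added on the left to avoid truncated subtraction.\<close>

lemma length_str_subst_tm:
  "length (str_tm (subst_tm x s u)) + occ_tm x u =
    length (str_tm u) + occ_tm x u * length (str_tm s)"
  by (induction u) (auto simp: algebra_simps)

lemma len_subst_fm:
  "len_fm (subst_fm x s \<alpha>) + free_occ x \<alpha> =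
    len_fm \<alpha> + free_occ x \<alpha> * length (str_tm s)"
  unfolding len_fm_def
proof (induction \<alpha>)
  case (Eq u w)
  then show ?case
    using length_str_subst_tm[of x s u] length_str_subst_tm[of x s w] by (simp add: algebra_simps)
next
  case (Leq u w)
  then show ?case
    using length_str_subst_tm[of x s u] length_str_subst_tm[of x s w] by (simp add: algebra_simps)
qed (auto simp: algebra_simps)

lemma length_str_num [simp]: "length (str_tm (num i)) = Suc i"
  by (induction i) auto

text \<open>The numeral of 10 takes 11 symbols, the two numerals of \<open>k\<close> take
  \<open>2 * (k + 1)\<close>, and two products take 6 for brackets and signs.\<close>

lemma length_str_boolos_term: "length (str_tm (boolos_term k)) = 2 * k + 19"
  by (simp add: boolos_term_def)

lemma len_psi_ge: "5 \<le> len_fm (psi \<phi>)"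
  by (simp add: psi_def len_fm_def Less_def)

lemma vars_boolos_term [simp]: "vars_tm (boolos_term k) = {}"
  by (simp add: boolos_term_def)

lemma val_boolos_term: "val e (boolos_term k) = 10 * k\<^sup>2"
  by (simp add: boolos_term_def power2_eq_square del: num.simps)

text \<open>With \<open>m\<close> free occurrences of \<open>v_1\<close>, the new length is
  \<open>k1 + m * (2 * k + 18)\<close>. Here \<open>k1\<close> is at most \<open>k\<close>, and
  \<open>m\<close> at most \<open>k2\<close>, hence at most \<open>k / 5\<close>; so at most 6.6
  times the square of \<open>k\<close> is used. Strictness comes from \<open>k2 > 0\<close>.\<close>

lemma len_psi_subst_less:
  assumes "k2 > free_occ 1 (psi \<phi>)" and k: "k = len_fm (psi \<phi>) * k2"
  shows "len_fm (subst_fm 1 (boolos_term k) (psi \<phi>)) < 10 * k\<^sup>2"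
proof -
  let ?m = "free_occ 1 (psi \<phi>)" and ?k1 = "len_fm (psi \<phi>)"
  have len: "len_fm (subst_fm 1 (boolos_term k) (psi \<phi>)) + ?m = ?k1 + ?m * (2 * k + 19)"
    using len_subst_fm[of 1 "boolos_term k" "psi \<phi>"] by (simp add: length_str_boolos_term)
  have m: "?m \<le> k2" "0 < k2" using assms(1) by auto
  have "5 * k2 \<le> k" using len_psi_ge[of \<phi>] k by simp
  moreover have "?k1 \<le> k" using m k by simp
  moreover have "k \<le> k\<^sup>2" by (simp add: power2_eq_square)
  moreover have "?m * (2 * k) \<le> 2 * k\<^sup>2"
  proof -
    have "?m \<le> k" using m \<open>5 * k2 \<le> k\<close> by linarith
    then have "?m * k \<le> k * k" by (rule mult_le_mono1)
    then show ?thesis by (simp add: power2_eq_square)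
  qed
  ultimately show ?thesis using len m by (simp add: algebra_simps)
qed


section \<open>The unprovable sentence\<close>

text \<open>Identifies \<open>psi(v_0,t)\<close> with \<open>psi\<close> of the one-variable formula
  \<open>\<phi>(v_0,t)\<close>, the form that \<open>names_psi\<close> expects.\<close>

lemma subst_psi:
  assumes "x \<noteq> 0" "x \<noteq> 2" "vars_tm s = {}"
  shows "subst_fm x s (psi \<phi>) = psi (subst_fm x s \<phi>)"
  using assms by (simp add: psi_def Less_def subst_fm_commute)

lemma sat_psi:
  assumes "free_for (Var 2) 0 \<phi>" "2 \<notin> fv \<phi>"
  shows "sat e (psi \<phi>) \<longleftrightarrow> \<not> sat e \<phi> \<and> (\<forall>a < e 0. sat (e(0 := a)) \<phi>)"
proof -
  \<comment> \<open>The value left at \<open>v_2\<close> by the quantifier is invisible to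
    \<open>\<phi>\<close>.\<close>
  have "sat (e(2 := a, 0 := a)) \<phi> = sat (e(0 := a)) \<phi>" for a
    by (rule sat_cong) (use assms(2) in auto)
  then show ?thesis
    by (auto simp: psi_def Less_def sat_subst_fm[OF assms(1)])
qed

theorem mainTheorem1:
  fixes T :: "fm set" and g :: "nat \<Rightarrow> nat" and \<phi> :: fm and k1 k2 k n :: nat and t :: tm
  assumes "\<forall>\<alpha>\<in>T. sentence \<alpha>"
    and "consistent T"
    and "extends_Q T"
    and "definable (Pr T)"
    and "recursive_fun g" and "bounds_goedel g"
    and "defines_rel \<phi> (\<B> T g)"
    and "recursively_axiomatizable T \<longrightarrow> Sigma1 \<phi>"
    and "free_for (Var 2) 0 \<phi>"
    and "k1 = len_fm (psi \<phi>)"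
    and "k2 > free_occ 1 (psi \<phi>)"
    and "k = k1 * k2"
    and "t = boolos_term k"
    and "n = least_unnamed T (10 * k\<^sup>2)"
  shows "true_in_omega (psi_inst \<phi> (num n) t) \<and> \<not> T \<turnstile> psi_inst \<phi> (num n) t"
proof -
  interpret arith_theory T by unfold_locales (use assms in auto)
  define j where "j = 10 * k\<^sup>2"
  define named where "named i \<longleftrightarrow> (\<exists>\<mu>. len_fm \<mu> < j \<and> names T \<mu> i)" for i
  have n: "n = (LEAST i. \<not> named i)"
    using assms(14) by (simp add: least_unnamed_def named_def j_def)
  have "finite {i. named i}" using finite_named[OF assms(2)] by (simp add: named_def)
  then have "\<exists>i. \<not> named i" using ex_new_if_finite infinite_UNIV_nat by blast
  then have not_named: "\<not> named n" unfolding n by (rule LeastI_ex)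
  have named_below: "named i" if "i < n" for i using not_less_Least that n by blast
  have fv: "fv \<phi> \<subseteq> {0, 1}" and
    B_iff: "\<And>e i j. (i, j) \<in> \<B> T g \<longleftrightarrow> sat (e(0 := i, 1 := j)) \<phi>"
    using assms(7) by (auto simp: defines_rel_def)

  \<comment> \<open>The bound \<open>g j\<close> in \<open>\<B>\<close> loses no named number: a
    name in the first \<open>j\<close> variables has a small enough Goedel number by
    \<open>bounds_goedel\<close>.\<close>
  have in_B: "(i, j) \<in> \<B> T g \<longleftrightarrow> named i" for i
  proof
    assume "named i"
    then obtain \<mu> where "vars_fm \<mu> \<subseteq> {..<j}" "len_fm \<mu> < j" "names T \<mu> i"
      using names_bounded_vars unfolding named_def by blast
    then show "(i, j) \<in> \<B> T g" using assms(6) by (auto simp: \<B>_def bounds_goedel_def)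
  qed (auto simp: \<B>_def named_def)
  have "sat e (psi_inst \<phi> (num n) t)" for e
  proof -
    have "sat e (psi_inst \<phi> (num n) t) \<longleftrightarrow> sat (e(1 := j, 0 := n)) (psi \<phi>)"
      unfolding psi_inst_def assms(13)
      by (simp add: sat_subst_fm free_for_closed val_boolos_term j_def)
    \<comment> \<open>\<open>defines_rel\<close> updates \<open>e\<close> at 0 first and at 1
      second, the opposite of the order here, hence \<open>fun_upd_twist\<close>.\<close>
    also have "\<dots> \<longleftrightarrow> \<not> named n \<and> (\<forall>a<n. named a)"
      using fv by (subst sat_psi[OF assms(9)]) (auto simp flip: in_B simp: B_iff[of _ _ e] fun_upd_twist)
    finally show ?thesis using not_named named_below by blast
  qed
  moreover have "\<not> T \<turnstile> psi_inst \<phi> (num n) t"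
  proof
    let ?\<chi> = "subst_fm 1 t \<phi>"
    assume "T \<turnstile> psi_inst \<phi> (num n) t"
    moreover have t: "vars_tm t = {}" using assms(13) by simp
    \<comment> \<open>The substitution of \<open>t\<close> is moved inside that of
      \<open>num n\<close>, both terms being closed; \<open>Suc 0\<close> is the simplifier's form
      of 1.\<close>
    ultimately have "T \<turnstile> subst_fm 0 (num n) (psi ?\<chi>)"
      by (simp add: psi_inst_def subst_fm_commute[of "Suc 0" 0] subst_psi)
    then have "names T (psi ?\<chi>) n"
      using fv assms(9) t by (intro names_psi) (auto simp: fv_subst_closed free_for_subst_closed)
    moreover have "len_fm (psi ?\<chi>) < j"
      using len_psi_subst_less[of \<phi> k2 k] assms(10-13) t by (simp add: subst_psi j_def)
    ultimately show False using not_named by (auto simp: named_def)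
  qed
  ultimately show ?thesis by (simp add: true_in_omega_def)
qed

end
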